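(* Let ${\cal N}=(\mathbb{N},{\rm lcm},\gcd,|,1,0)$ be the bounded lattice of the natural numbers (including $0$) ordered by divisibility, with join ${\rm lcm}$, meet $\gcd$, bottom element $1$ and top element $0$. Let $D({\cal N})$ be the bounded lattice obtained from ${\cal N}$ by adding, for each pair $a<b$ in ${\cal N}$ with $b$ not covering $a$, two new elements $l_{a,b},r_{a,b}$ between $a$ and $b$ (as defined in the context). Then $D({\cal N})$ is a simple lattice, $|{\rm Filt}(D({\cal N}))|=\aleph_0$ and $|{\rm Id}(D({\cal N}))|=2^{\aleph_0}$. Hence the cardinalities $|{\rm Con}(D({\cal N}))|$, $|{\rm Filt}(D({\cal N}))|$ and $|{\rm Id}(D({\cal N}))|$ are pairwise distinct.
   Context: For a lattice $L$, ${\rm Con}(L)$, ${\rm Filt}(L)$ and ${\rm Id}(L)$ are the sets of its congruences, of its (non-empty) filters and of its (non-empty) ideals, respectively. $\prec$ denotes the cover relation. A lattice is simple if it has exactly two congruences, the equality and the full relation. The Continuum Hypothesis is not assumed. Definition of $D(L)$: let $(L,\leq,0_L,1_L)$ be a bounded lattice with at least two elements. The underlying set of $D(L)$ is the disjoint union of $L$ and $\{l_{a,b},r_{a,b}\mid a,b\in L,\ a<b,\ a\nprec b\}$, where all the elements $l_{a,b},r_{a,b}$ are new and pairwise distinct. The order $\leq$ on $D(L)$ extends that of $L$ as follows, where $m$ stands for either of $l_{a,b},r_{a,b}$ and $m'$ for either of $l_{c,d},r_{c,d}$: for $x\in L$, $x\leq m$ iff $x\leq a$ in $L$; for $y\in L$,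 $m\leq y$ iff $b\leq y$ in $L$; and $m\leq m'$ iff $m=m'$ or $b\leq c$ in $L$. This is a bounded lattice with the same bottom and top as $L$. For $L={\cal N}$, the order $\leq$ of $L$ is divisibility. *)

theory Defs
  imports "HOL-Algebra.Lattice" "HOL-Library.Equipollence"
begin

section \<open>Congruences, filters, ideals\<close>

definition congruence :: "('a, 'c) gorder_scheme \<Rightarrow> ('a \<times> 'a) set \<Rightarrow> bool" where
  "congruence L \<theta> \<longleftrightarrow> equiv (carrier L) \<theta> \<and>
     (\<forall>x y u v. (x, y) \<in> \<theta> \<longrightarrow> (u, v) \<in> \<theta> \<longrightarrow>
        (x \<squnion>\<^bsub>L\<^esub> u, y \<squnion>\<^bsub>L\<^esub> v) \<in> \<theta> \<and> (x \<sqinter>\<^bsub>L\<^esub> u, y \<sqinter>\<^bsub>L\<^esub> v) \<in> \<theta>)"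

definition Con :: "('a, 'c) gorder_scheme \<Rightarrow> ('a \<times> 'a) set set" where
  "Con L = {\<theta>. congruence L \<theta>}"

definition Filt :: "('a, 'c) gorder_scheme \<Rightarrow> 'a set set" where
  "Filt L = {F. F \<subseteq> carrier L \<and> F \<noteq> {} \<and>
     (\<forall>x\<in>F. \<forall>y\<in>F. x \<sqinter>\<^bsub>L\<^esub> y \<in> F) \<and>
     (\<forall>x\<in>F. \<forall>y\<in>carrier L. x \<sqsubseteq>\<^bsub>L\<^esub> y \<longrightarrow> y \<in> F)}"

definition Idl :: "('a, 'c) gorder_scheme \<Rightarrow> 'a set set" where
  "Idl L = {I. I \<subseteq> carrier L \<and> I \<noteq> {} \<and>
     (\<forall>x\<in>I. \<forall>y\<in>I. x \<squnion>\<^bsub>L\<^esub> y \<in> I) \<and>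
     (\<forall>x\<in>I. \<forall>y\<in>carrier L. y \<sqsubseteq>\<^bsub>L\<^esub> x \<longrightarrow> y \<in> I)}"

definition simple_lattice :: "('a, 'c) gorder_scheme \<Rightarrow> bool" where
  "simple_lattice L \<longleftrightarrow> lattice L \<and>
     Con L = {Id_on (carrier L), carrier L \<times> carrier L} \<and>
     Id_on (carrier L) \<noteq> carrier L \<times> carrier L"


section \<open>The construction \<open>D(L)\<close>\<close>

definition covered_by :: "('a, 'c) gorder_scheme \<Rightarrow> 'a \<Rightarrow> 'a \<Rightarrow> bool" where
  "covered_by L a b \<longleftrightarrow> a \<sqsubset>\<^bsub>L\<^esub> b \<and> \<not> (\<exists>c\<in>carrier L. a \<sqsubset>\<^bsub>L\<^esub> c \<and> c \<sqsubset>\<^bsub>L\<^esub> b)"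

datatype 'a D_elem = Orig 'a | Lft 'a 'a | Rgt 'a 'a

text \<open>
  The datatype also has values \<open>Lft a b\<close> and \<open>Rgt a b\<close> for unsuitable pairs \<open>(a, b)\<close>;
  these are excluded by the carrier.
\<close>

definition D_carrier :: "('a, 'c) gorder_scheme \<Rightarrow> 'a D_elem set" where
  "D_carrier L = Orig ` carrier L \<union>
     {m. \<exists>a\<in>carrier L. \<exists>b\<in>carrier L. a \<sqsubset>\<^bsub>L\<^esub> b \<and> \<not> covered_by L a b \<and>
           (m = Lft a b \<or> m = Rgt a b)}"

fun D_le :: "('a, 'c) gorder_scheme \<Rightarrow> 'a D_elem \<Rightarrow> 'a D_elem \<Rightarrow> bool" where
  "D_le L (Orig x) (Orig y) \<longleftrightarrow> x \<sqsubseteq>\<^bsub>L\<^esub> y"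
| "D_le L (Orig x) (Lft a b) \<longleftrightarrow> x \<sqsubseteq>\<^bsub>L\<^esub> a"
| "D_le L (Orig x) (Rgt a b) \<longleftrightarrow> x \<sqsubseteq>\<^bsub>L\<^esub> a"
| "D_le L (Lft a b) (Orig y) \<longleftrightarrow> b \<sqsubseteq>\<^bsub>L\<^esub> y"
| "D_le L (Rgt a b) (Orig y) \<longleftrightarrow> b \<sqsubseteq>\<^bsub>L\<^esub> y"
| "D_le L (Lft a b) (Lft c d) \<longleftrightarrow> Lft a b = Lft c d \<or> b \<sqsubseteq>\<^bsub>L\<^esub> c"
| "D_le L (Lft a b) (Rgt c d) \<longleftrightarrow> b \<sqsubseteq>\<^bsub>L\<^esub> c"
| "D_le L (Rgt a b) (Lft c d) \<longleftrightarrow> b \<sqsubseteq>\<^bsub>L\<^esub> c"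
| "D_le L (Rgt a b) (Rgt c d) \<longleftrightarrow> Rgt a b = Rgt c d \<or> b \<sqsubseteq>\<^bsub>L\<^esub> c"

definition D :: "('a, 'c) gorder_scheme \<Rightarrow> 'a D_elem gorder" where
  "D L = \<lparr>carrier = D_carrier L, eq = (=), le = D_le L\<rparr>"


section \<open>The lattice of natural numbers under divisibility\<close>

definition nat_dvd :: "nat gorder" where
  "nat_dvd = \<lparr>carrier = UNIV, eq = (=), le = (dvd)\<rparr>"

lemma nat_dvd_simps [simp]:
  "carrier nat_dvd = UNIV" "x .=\<^bsub>nat_dvd\<^esub> y \<longleftrightarrow> x = y" "x \<sqsubseteq>\<^bsub>nat_dvd\<^esub> y \<longleftrightarrow> x dvd y"
  by (simp_all add: nat_dvd_def)

lemma least_nat_dvd_lcm: "least nat_dvd (lcm x y) (Upper nat_dvd {x, y})"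
  by (auto simp: least_def Upper_def)

lemma greatest_nat_dvd_gcd: "greatest nat_dvd (gcd x y) (Lower nat_dvd {x, y})"
  by (auto simp: greatest_def Lower_def)

lemma bounded_lattice_nat_dvd: "bounded_lattice nat_dvd"
proof unfold_locales
  show "\<exists>s. least nat_dvd s (Upper nat_dvd {x, y})" for x y
    using least_nat_dvd_lcm by blast
  show "\<exists>s. greatest nat_dvd s (Lower nat_dvd {x, y})" for x y
    using greatest_nat_dvd_gcd by blast
  show "\<exists>x. least nat_dvd x (carrier nat_dvd)"
    by (rule exI[of _ 1]) (simp add: least_def)
  show "\<exists>x. greatest nat_dvd x (carrier nat_dvd)"
    by (rule exI[of _ 0]) (simp add: greatest_def)
qed (auto simp: nat_dvd_def intro: dvd_antisym dvd_trans)

interpretation nat_dvd: bounded_lattice nat_dvd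
  by (rule bounded_lattice_nat_dvd)

lemma nat_dvd_join: "x \<squnion>\<^bsub>nat_dvd\<^esub> y = lcm x y"
  by (rule dvd_antisym)
    (use nat_dvd.join_le[of x "lcm x y" y] nat_dvd.join_left[of x y] nat_dvd.join_right[of x y] in auto)

lemma nat_dvd_meet: "x \<sqinter>\<^bsub>nat_dvd\<^esub> y = gcd x y"
  by (rule dvd_antisym)
    (use nat_dvd.meet_le[of "gcd x y" x y] nat_dvd.meet_left[of x y] nat_dvd.meet_right[of x y] in auto)

lemma nat_dvd_bottom: "\<bottom>\<^bsub>nat_dvd\<^esub> = 1"
  using nat_dvd.bottom_eq[of 1] by simp

lemma nat_dvd_top: "\<top>\<^bsub>nat_dvd\<^esub> = 0"
  using nat_dvd.top_eq[of 0] by simp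

end

theory Submission
  imports Defs "HOL-Library.Countable_Set" "HOL-Computational_Algebra.Primes"
begin

text \<open>
  Each element \<open>x\<close> of \<open>D(L)\<close> occupies an interval \<open>[lo x, hi x]\<close> of \<open>L\<close>, which is a single point
  for \<open>x \<in> L\<close> and is \<open>[a, b]\<close> for the two elements added between \<open>a\<close> and \<open>b\<close>. Then \<open>x \<le> y\<close> in
  \<open>D(L)\<close> iff \<open>x = y\<close> or \<open>hi x \<le> lo y\<close> (\<open>D_le_iff\<close>), and with this description all case
  distinctions on the kind of element disappear. In particular the join of two incomparable
  elements is \<open>hi x \<squnion> hi y\<close> and their meet is \<open>lo x \<sqinter> lo y\<close>, both computed in \<open>L\<close>.
  
  Simplicity holds for every bounded lattice \<open>L\<close> with \<open>\<bottom> \<noteq> \<top>\<close>. If \<open>a < c < b\<close> in \<open>L\<close>, then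
  \<open>a, b\<close>, the two elements added between them and \<open>c\<close> form a diamond \<open>M\<^sub>3\<close> (\<open>D_M3\<close>), so a
  congruence that collapses one of its edges identifies \<open>a\<close> with \<open>b\<close> (\<open>congruence_D_M3\<close>). This is
  used three times: to push a nontrivial identification in \<open>D(L)\<close> down to some \<open>p < q\<close> in \<open>L\<close>
  (\<open>congruence_D_restrict\<close>), then to replace \<open>p\<close> by \<open>\<bottom>\<close>, and finally to replace \<open>q\<close> by \<open>\<top>\<close>
  (\<open>congruence_D_bottom_top\<close>).
  
  Divisibility on the natural numbers satisfies the descending chain condition, even with the
  top element \<open>0\<close>, and \<open>D\<close> preserves this condition (\<open>wf_D\<close>). Hence all filters of \<open>D(N)\<close> are
  principal, and there are as many of them as elements of the countable lattice \<open>D(N)\<close>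
  (\<open>Filt_eqpoll_carrier\<close>). On the other hand, every set of primes \<open>A\<close> gives the ideal of all
  nonzero numbers whose prime factors lie in \<open>A\<close>, so \<open>N\<close> has continuum many ideals, and each
  ideal of \<open>N\<close> is the trace of an ideal of \<open>D(N)\<close> (\<open>Idl_lepoll_Idl_D\<close>). Thus \<open>D(N)\<close> has two
  congruences, countably many filters and continuum many ideals.
\<close>

section \<open>The order and the lattice operations of \<open>D(L)\<close>\<close>

fun lo :: "'a D_elem \<Rightarrow> 'a" where
  "lo (Orig x) = x" | "lo (Lft a b) = a" | "lo (Rgt a b) = a"

fun hi :: "'a D_elem \<Rightarrow> 'a" where
  "hi (Orig x) = x" | "hi (Lft a b) = b" | "hi (Rgt a b) = b"

lemma D_eq_simp [simp]: "x .=\<^bsub>D L\<^esub> y \<longleftrightarrow> x = y"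
  by (simp add: D_def)

lemma Orig_in_D [simp]: "Orig x \<in> carrier (D L) \<longleftrightarrow> x \<in> carrier L"
  by (auto simp: D_def D_carrier_def)

lemma lo_closed [simp]: "x \<in> carrier (D L) \<Longrightarrow> lo x \<in> carrier L"
  and hi_closed [simp]: "x \<in> carrier (D L) \<Longrightarrow> hi x \<in> carrier L"
  by (auto simp: D_def D_carrier_def)

context partial_order
begin

text \<open>
  A pair \<open>a < b\<close> that is not a cover is the same as a pair with an element strictly in between;
  that element is the third atom of the diamond used below.
\<close>

lemma Lft_in_D_iff:
    "Lft a b \<in> carrier (D L) \<longleftrightarrow>
     a \<in> carrier L \<and> b \<in> carrier L \<and> (\<exists>c\<in>carrier L. a \<sqsubset> c \<and> c \<sqsubset> b)"
  and Rgt_in_D_iff: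
    "Rgt a b \<in> carrier (D L) \<longleftrightarrow>
     a \<in> carrier L \<and> b \<in> carrier L \<and> (\<exists>c\<in>carrier L. a \<sqsubset> c \<and> c \<sqsubset> b)"
  using lless_trans by (auto simp: D_def D_carrier_def covered_by_def)

lemma D_le_iff:
  assumes "x \<in> carrier (D L)" "y \<in> carrier (D L)"
  shows "x \<sqsubseteq>\<^bsub>D L\<^esub> y \<longleftrightarrow> x = y \<or> hi x \<sqsubseteq> lo y"
  using assms by (cases x; cases y) (auto simp: D_def D_carrier_def)

lemma lo_le_hi: "x \<in> carrier (D L) \<Longrightarrow> lo x \<sqsubseteq> hi x"
  by (auto simp: D_def D_carrier_def lless_def)

text \<open>
  The added elements occupy proper intervals, which is what makes the order antisymmetric:
  \<open>hi x \<le> lo y\<close> and \<open>hi y \<le> lo x\<close> shrink both intervals to the same point.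
\<close>

lemma lo_eq_hi_iff: "x \<in> carrier (D L) \<Longrightarrow> lo x = hi x \<longleftrightarrow> x = Orig (lo x)"
  by (auto simp: D_def D_carrier_def lless_eq)

lemma D_le_lo_hi:
  assumes "x \<in> carrier (D L)" "y \<in> carrier (D L)" "x \<sqsubseteq>\<^bsub>D L\<^esub> y"
  shows "lo x \<sqsubseteq> lo y" "hi x \<sqsubseteq> hi y"
  using assms D_le_iff[of x y] lo_le_hi[of x] lo_le_hi[of y]
  by (metis le_refl le_trans lo_closed hi_closed)+

lemma partial_order_D: "partial_order (D L)"
proof (unfold_locales, goal_cases)
  \<comment> \<open>antisymmetry\<close>
  case (5 x y)
  show ?case
  proof (cases "x = y")
    case False
    then have le: "hi x \<sqsubseteq> lo y" "hi y \<sqsubseteq> lo x" using 5 D_le_iff by auto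
    have "lo x = hi x" "lo y = hi y" "lo x = lo y"
      using le lo_le_hi[of x] lo_le_hi[of y] 5
      by (metis le_antisym le_trans lo_closed hi_closed)+
    then show ?thesis using 5 lo_eq_hi_iff by (metis D_eq_simp)
  qed simp
next
  \<comment> \<open>transitivity\<close>
  case (6 x y z)
  then have "hi x \<sqsubseteq> lo z" if "hi x \<sqsubseteq> lo y" "hi y \<sqsubseteq> lo z"
    using that lo_le_hi[of y] by (meson le_trans lo_closed hi_closed)
  with 6 show ?case by (auto simp: D_le_iff)
qed (auto simp: D_le_iff fun_eq_iff)

end

context lattice
begin

text \<open>
  Any upper bound \<open>z\<close> of incomparable \<open>x\<close> and \<open>y\<close> differs from both, so being an upper bound only
  means that \<open>lo z\<close> is an upper bound of \<open>hi x\<close> and \<open>hi y\<close> in \<open>L\<close>.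
\<close>

lemma least_D_join:
  assumes x: "x \<in> carrier (D L)" and y: "y \<in> carrier (D L)"
    and inc: "\<not> x \<sqsubseteq>\<^bsub>D L\<^esub> y" "\<not> y \<sqsubseteq>\<^bsub>D L\<^esub> x"
  shows "least (D L) (Orig (hi x \<squnion> hi y)) (Upper (D L) {x, y})"
proof (rule least_UpperI)
  fix z assume "z \<in> {x, y}"
  then show "z \<sqsubseteq>\<^bsub>D L\<^esub> Orig (hi x \<squnion> hi y)"
    using x y by (auto simp: D_le_iff join_left join_right)
next
  fix z assume "z \<in> Upper (D L) {x, y}"
  then have z: "z \<in> carrier (D L)" "x \<sqsubseteq>\<^bsub>D L\<^esub> z" "y \<sqsubseteq>\<^bsub>D L\<^esub> z"
    using x y by (auto simp: Upper_def)
  then have "hi x \<sqsubseteq> lo z" "hi y \<sqsubseteq> lo z"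
    using x y inc D_le_iff by metis+
  then show "Orig (hi x \<squnion> hi y) \<sqsubseteq>\<^bsub>D L\<^esub> z"
    using x y z by (simp add: D_le_iff join_le)
qed (use x y in auto)

lemma greatest_D_meet:
  assumes x: "x \<in> carrier (D L)" and y: "y \<in> carrier (D L)"
    and inc: "\<not> x \<sqsubseteq>\<^bsub>D L\<^esub> y" "\<not> y \<sqsubseteq>\<^bsub>D L\<^esub> x"
  shows "greatest (D L) (Orig (lo x \<sqinter> lo y)) (Lower (D L) {x, y})"
proof (rule greatest_LowerI)
  fix z assume "z \<in> {x, y}"
  then show "Orig (lo x \<sqinter> lo y) \<sqsubseteq>\<^bsub>D L\<^esub> z"
    using x y by (auto simp: D_le_iff meet_left meet_right)
next
  fix z assume "z \<in> Lower (D L) {x, y}"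
  then have z: "z \<in> carrier (D L)" "z \<sqsubseteq>\<^bsub>D L\<^esub> x" "z \<sqsubseteq>\<^bsub>D L\<^esub> y"
    using x y by (auto simp: Lower_def)
  then have "hi z \<sqsubseteq> lo x" "hi z \<sqsubseteq> lo y"
    using x y inc D_le_iff by metis+
  then show "z \<sqsubseteq>\<^bsub>D L\<^esub> Orig (lo x \<sqinter> lo y)"
    using x y z by (simp add: D_le_iff meet_le)
qed (use x y in auto)

lemma lattice_D: "lattice (D L)"
proof -
  interpret D: partial_order "D L" by (rule partial_order_D)
  show ?thesis
  proof
    fix x y assume xy: "x \<in> carrier (D L)" "y \<in> carrier (D L)"
    consider "x \<sqsubseteq>\<^bsub>D L\<^esub> y" | "y \<sqsubseteq>\<^bsub>D L\<^esub> x" | "\<not> x \<sqsubseteq>\<^bsub>D L\<^esub> y" "\<not> y \<sqsubseteq>\<^bsub>D L\<^esub> x" by blast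
    then show "\<exists>s. least (D L) s (Upper (D L) {x, y})"
    proof cases
      case 1 with xy show ?thesis by (intro exI[of _ y]) (auto simp: least_def Upper_def)
    next
      case 2 with xy show ?thesis by (intro exI[of _ x]) (auto simp: least_def Upper_def)
    next
      case 3 from least_D_join[OF xy 3] show ?thesis by (rule exI)
    qed
    consider "x \<sqsubseteq>\<^bsub>D L\<^esub> y" | "y \<sqsubseteq>\<^bsub>D L\<^esub> x" | "\<not> x \<sqsubseteq>\<^bsub>D L\<^esub> y" "\<not> y \<sqsubseteq>\<^bsub>D L\<^esub> x" by blast
    then show "\<exists>s. greatest (D L) s (Lower (D L) {x, y})"
    proof cases
      case 1 with xy show ?thesis by (intro exI[of _ x]) (auto simp: greatest_def Lower_def)
    next
      case 2 with xy show ?thesis by (intro exI[of _ y]) (auto simp: greatest_def Lower_def)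
    next
      case 3 from greatest_D_meet[OF xy 3] show ?thesis by (rule exI)
    qed
  qed
qed

lemma D_join_incomparable:
  assumes "x \<in> carrier (D L)" "y \<in> carrier (D L)" "\<not> x \<sqsubseteq>\<^bsub>D L\<^esub> y" "\<not> y \<sqsubseteq>\<^bsub>D L\<^esub> x"
  shows "x \<squnion>\<^bsub>D L\<^esub> y = Orig (hi x \<squnion> hi y)"
proof -
  interpret D: lattice "D L" by (rule lattice_D)
  show ?thesis
    using D.sup_of_two_least[of x y] least_D_join[OF assms] D.least_unique assms(1,2)
    unfolding join_def by blast
qed

lemma D_meet_incomparable:
  assumes "x \<in> carrier (D L)" "y \<in> carrier (D L)" "\<not> x \<sqsubseteq>\<^bsub>D L\<^esub> y" "\<not> y \<sqsubseteq>\<^bsub>D L\<^esub> x"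
  shows "x \<sqinter>\<^bsub>D L\<^esub> y = Orig (lo x \<sqinter> lo y)"
proof -
  interpret D: lattice "D L" by (rule lattice_D)
  show ?thesis
    using D.inf_of_two_greatest[of x y] greatest_D_meet[OF assms] D.greatest_unique assms(1,2)
    unfolding meet_def by blast
qed

lemma join_eq_right: "x \<in> carrier L \<Longrightarrow> y \<in> carrier L \<Longrightarrow> x \<sqsubseteq> y \<Longrightarrow> x \<squnion> y = y"
  by (metis le_iff_meet)

lemma join_eq_left: "x \<in> carrier L \<Longrightarrow> y \<in> carrier L \<Longrightarrow> y \<sqsubseteq> x \<Longrightarrow> x \<squnion> y = x"
  by (metis join_eq_right join_comm)

lemma meet_eq_left: "x \<in> carrier L \<Longrightarrow> y \<in> carrier L \<Longrightarrow> x \<sqsubseteq> y \<Longrightarrow> x \<sqinter> y = x"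
  by (metis le_iff_join)

lemma meet_eq_right: "x \<in> carrier L \<Longrightarrow> y \<in> carrier L \<Longrightarrow> y \<sqsubseteq> x \<Longrightarrow> x \<sqinter> y = y"
  by (metis meet_eq_left meet_comm)

end

lemma (in bounded_lattice) bounded_lattice_D: "bounded_lattice (D L)"
proof -
  interpret D: lattice "D L" by (rule lattice_D)
  show ?thesis
  proof
    show "\<exists>x. least (D L) x (carrier (D L))"
      by (rule exI[of _ "Orig \<bottom>"]) (auto simp: least_def D_le_iff)
    show "\<exists>x. greatest (D L) x (carrier (D L))"
      by (rule exI[of _ "Orig \<top>"]) (auto simp: greatest_def D_le_iff)
  qed
qed

section \<open>Simplicity of \<open>D(L)\<close>\<close>

lemma congruence_refl: "congruence L \<theta> \<Longrightarrow> x \<in> carrier L \<Longrightarrow> (x, x) \<in> \<theta>"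
  unfolding congruence_def equiv_def by (meson refl_onD)

lemma congruence_sym: "congruence L \<theta> \<Longrightarrow> (x, y) \<in> \<theta> \<Longrightarrow> (y, x) \<in> \<theta>"
  unfolding congruence_def equiv_def by (meson symD)

lemma congruence_trans: "congruence L \<theta> \<Longrightarrow> (x, y) \<in> \<theta> \<Longrightarrow> (y, z) \<in> \<theta> \<Longrightarrow> (x, z) \<in> \<theta>"
  unfolding congruence_def equiv_def by (meson transD)

lemma congruence_subset: "congruence L \<theta> \<Longrightarrow> \<theta> \<subseteq> carrier L \<times> carrier L"
  unfolding congruence_def using equiv_type by blast

lemma congruence_join:
  "congruence L \<theta> \<Longrightarrow> (x, y) \<in> \<theta> \<Longrightarrow> z \<in> carrier L \<Longrightarrow> (x \<squnion>\<^bsub>L\<^esub> z, y \<squnion>\<^bsub>L\<^esub> z) \<in> \<theta>"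
  using congruence_refl[of L \<theta> z] unfolding congruence_def by blast

lemma congruence_meet:
  "congruence L \<theta> \<Longrightarrow> (x, y) \<in> \<theta> \<Longrightarrow> z \<in> carrier L \<Longrightarrow> (x \<sqinter>\<^bsub>L\<^esub> z, y \<sqinter>\<^bsub>L\<^esub> z) \<in> \<theta>"
  using congruence_refl[of L \<theta> z] unfolding congruence_def by blast

context lattice
begin

lemma D_M3:
  assumes ac: "a \<sqsubset> c" "c \<sqsubset> b" and carr: "a \<in> carrier L" "b \<in> carrier L" "c \<in> carrier L"
    and pq: "p \<in> {Orig c, Lft a b, Rgt a b}" "q \<in> {Orig c, Lft a b, Rgt a b}" "p \<noteq> q"
  shows "p \<squnion>\<^bsub>D L\<^esub> q = Orig b" "p \<sqinter>\<^bsub>D L\<^esub> q = Orig a"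
proof -
  have ne: "a \<sqsubseteq> c" "c \<sqsubseteq> b" "a \<noteq> c" "c \<noteq> b"
    using ac by (simp_all add: lless_eq)
  then have "\<not> c \<sqsubseteq> a" "\<not> b \<sqsubseteq> c"
    using carr le_antisym by metis+
  moreover from this have "\<not> b \<sqsubseteq> a" using ne carr le_trans by metis
  ultimately have le: "a \<sqsubseteq> c" "c \<sqsubseteq> b" "\<not> c \<sqsubseteq> a" "\<not> b \<sqsubseteq> c" "\<not> b \<sqsubseteq> a"
    using ne by simp_all
  have D: "p \<in> carrier (D L)" "q \<in> carrier (D L)"
    using pq ac carr by (auto simp: Lft_in_D_iff Rgt_in_D_iff)
  then have inc: "\<not> p \<sqsubseteq>\<^bsub>D L\<^esub> q" "\<not> q \<sqsubseteq>\<^bsub>D L\<^esub> p"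
    using pq le by (auto simp: D_le_iff)
  show "p \<squnion>\<^bsub>D L\<^esub> q = Orig b"
    using D_join_incomparable[OF D inc] pq le carr by (auto simp: join_eq_left join_eq_right)
  show "p \<sqinter>\<^bsub>D L\<^esub> q = Orig a"
    using D_meet_incomparable[OF D inc] pq le carr by (auto simp: meet_eq_left meet_eq_right)
qed

text \<open>
  The usual argument for the simplicity of \<open>M\<^sub>3\<close>, restricted to the edges at its top and bottom: if
  the atom \<open>p\<close> is identified with one end, then joining or meeting with another atom \<open>q\<close>
  identifies \<open>q\<close> with the opposite end, and a third atom \<open>s\<close> reached from both \<open>p\<close> and \<open>q\<close> is
  identified with both ends.
\<close>

lemma congruence_D_M3:
  assumes \<theta>: "congruence (D L) \<theta>"
    and ac: "a \<sqsubset> c" "c \<sqsubset> b" and carr: "a \<in> carrier L" "b \<in> carrier L" "c \<in> carrier L"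
    and p: "p \<in> {Orig c, Lft a b, Rgt a b}"
    and collapse: "(Orig a, p) \<in> \<theta> \<or> (p, Orig b) \<in> \<theta>"
  shows "(Orig a, Orig b) \<in> \<theta>"
proof -
  interpret D: lattice "D L" by (rule lattice_D)
  let ?M = "{Orig c, Lft a b, Rgt a b}"
  have M: "?M \<subseteq> carrier (D L)"
    using ac carr by (auto simp: Lft_in_D_iff Rgt_in_D_iff)
  have ends: "Orig a \<sqsubseteq>\<^bsub>D L\<^esub> q" "q \<sqsubseteq>\<^bsub>D L\<^esub> Orig b" if "q \<in> ?M" for q
  proof -
    have "q \<in> carrier (D L)" using that M by blast
    then show "Orig a \<sqsubseteq>\<^bsub>D L\<^esub> q" "q \<sqsubseteq>\<^bsub>D L\<^esub> Orig b"
      using that ac carr by (auto simp: D_le_iff lless_eq)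
  qed
  have up: "(s, Orig b) \<in> \<theta>" if "(Orig a, q) \<in> \<theta>" "q \<in> ?M" "s \<in> ?M" "q \<noteq> s" for q s
    using congruence_join[OF \<theta> that(1), of s] D_M3(1)[OF ac carr that(2,3,4)] that(3) M
      D.join_eq_right[OF _ _ ends(1)[OF that(3)]] carr by auto
  have down: "(Orig a, s) \<in> \<theta>" if "(q, Orig b) \<in> \<theta>" "q \<in> ?M" "s \<in> ?M" "q \<noteq> s" for q s
    using congruence_meet[OF \<theta> that(1), of s] D_M3(2)[OF ac carr that(2,3,4)] that(3) M
      D.meet_eq_right[OF _ _ ends(2)[OF that(3)]] carr by auto
  obtain q s where qs: "q \<in> ?M" "s \<in> ?M" "p \<noteq> q" "p \<noteq> s" "q \<noteq> s"
    using p by auto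
  have "(Orig a, s) \<in> \<theta> \<and> (s, Orig b) \<in> \<theta>"
    using collapse up down p qs by meson
  then show ?thesis using congruence_trans[OF \<theta>] by blast
qed

text \<open>
  A nontrivial congruence identifies some \<open>u < v\<close>. If \<open>u\<close> is an added element between \<open>a\<close> and
  \<open>b\<close>, then \<open>b \<le> v\<close>, so meeting with \<open>b\<close> identifies \<open>u\<close> with \<open>b\<close>, an edge of a diamond; dually
  for \<open>v\<close>. Otherwise \<open>u\<close> and \<open>v\<close> already lie in \<open>L\<close>.
\<close>

lemma congruence_D_restrict:
  assumes \<theta>: "congruence (D L) \<theta>" and xy: "(x, y) \<in> \<theta>" "x \<noteq> y"
  shows "\<exists>p\<in>carrier L. \<exists>q\<in>carrier L. p \<sqsubset> q \<and> (Orig p, Orig q) \<in> \<theta>"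
proof -
  interpret D: lattice "D L" by (rule lattice_D)
  have carr: "x \<in> carrier (D L)" "y \<in> carrier (D L)"
    using congruence_subset[OF \<theta>] xy by auto
  obtain u v where uv: "u \<in> carrier (D L)" "v \<in> carrier (D L)" "u \<sqsubseteq>\<^bsub>D L\<^esub> v" "u \<noteq> v" "(u, v) \<in> \<theta>"
  proof (cases "x \<sqsubseteq>\<^bsub>D L\<^esub> y")
    case True
    with carr xy show ?thesis by (intro that)
  next
    case False
    have "(x \<sqinter>\<^bsub>D L\<^esub> y, x) \<in> \<theta>"
      using congruence_meet[OF \<theta> congruence_sym[OF \<theta> xy(1)] carr(1)] carr
      by (simp add: D.meet_eq_left meet_comm[of "D L"])
    moreover have "x \<sqinter>\<^bsub>D L\<^esub> y \<noteq> x"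
      using False D.meet_right[OF carr] by auto
    ultimately show ?thesis
      using carr D.meet_left[OF carr] by (intro that[of "x \<sqinter>\<^bsub>D L\<^esub> y" x]) auto
  qed
  then have le: "hi u \<sqsubseteq> lo v" using D_le_iff by blast
  have M3: ?thesis
    if m: "m \<in> {Lft a b, Rgt a b}" "m \<in> carrier (D L)" "(Orig a, m) \<in> \<theta> \<or> (m, Orig b) \<in> \<theta>" for m a b
  proof -
    from m obtain c where c: "a \<in> carrier L" "b \<in> carrier L" "c \<in> carrier L" "a \<sqsubset> c" "c \<sqsubset> b"
      by (auto simp: Lft_in_D_iff Rgt_in_D_iff)
    then have "(Orig a, Orig b) \<in> \<theta>"
      using congruence_D_M3[OF \<theta> c(4,5,1,2,3), of m] m by blast
    moreover have "a \<sqsubset> b" by (rule lless_trans[OF c(4,5,1,3,2)])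
    ultimately show ?thesis using c(1,2) by blast
  qed
  have new_u: ?thesis if "u \<in> {Lft a b, Rgt a b}" for a b
  proof (rule M3[OF that uv(1)])
    have b: "hi u = b" using that by auto
    have bL: "b \<in> carrier L" using hi_closed[OF uv(1)] b by simp
    then have "(u \<sqinter>\<^bsub>D L\<^esub> Orig b, v \<sqinter>\<^bsub>D L\<^esub> Orig b) \<in> \<theta>"
      using congruence_meet[OF \<theta> uv(5)] bL by simp
    moreover have "u \<sqsubseteq>\<^bsub>D L\<^esub> Orig b" "Orig b \<sqsubseteq>\<^bsub>D L\<^esub> v" using le b bL uv by (auto simp: D_le_iff)
    ultimately show "(Orig a, u) \<in> \<theta> \<or> (u, Orig b) \<in> \<theta>"
      using uv bL by (simp add: D.meet_eq_left D.meet_eq_right)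
  qed
  have new_v: ?thesis if "v \<in> {Lft a b, Rgt a b}" for a b
  proof (rule M3[OF that uv(2)])
    have a: "lo v = a" using that by auto
    have aL: "a \<in> carrier L" using lo_closed[OF uv(2)] a by simp
    then have "(u \<squnion>\<^bsub>D L\<^esub> Orig a, v \<squnion>\<^bsub>D L\<^esub> Orig a) \<in> \<theta>"
      using congruence_join[OF \<theta> uv(5)] aL by simp
    moreover have "u \<sqsubseteq>\<^bsub>D L\<^esub> Orig a" "Orig a \<sqsubseteq>\<^bsub>D L\<^esub> v" using le a aL uv by (auto simp: D_le_iff)
    ultimately show "(Orig a, v) \<in> \<theta> \<or> (v, Orig b) \<in> \<theta>"
      using uv aL by (simp add: D.join_eq_left D.join_eq_right)
  qed
  show ?thesis
  proof (cases u)
    case u: (Orig p)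
    show ?thesis
    proof (cases v)
      case (Orig q)
      with u uv le show ?thesis by (auto simp: lless_eq)
    qed (use new_v in auto)
  qed (use new_u in auto)
qed

end

context bounded_lattice
begin

text \<open>
  If \<open>\<bottom> < p < q\<close>, then \<open>l = Lft \<bottom> q\<close> exists and satisfies \<open>p \<sqinter> l = \<bottom>\<close> and \<open>q \<sqinter> l = l\<close>. Hence
  \<open>p \<equiv> q\<close> gives \<open>\<bottom> \<equiv> l\<close>, an edge of the diamond with ends \<open>\<bottom>, q\<close> and atom \<open>p\<close>, and
  \<open>\<bottom> \<equiv> q\<close> follows. If moreover \<open>q < \<top>\<close>, then joining \<open>\<bottom> \<equiv> q\<close> with \<open>Lft \<bottom> \<top>\<close> collapses an edge
  of the diamond with ends \<open>\<bottom>, \<top>\<close> and atom \<open>q\<close>.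
\<close>

lemma congruence_D_bottom_top:
  assumes \<theta>: "congruence (D L) \<theta>"
    and pq: "p \<in> carrier L" "q \<in> carrier L" "p \<sqsubset> q" "(Orig p, Orig q) \<in> \<theta>"
  shows "(Orig \<bottom>, Orig \<top>) \<in> \<theta>"
proof -
  interpret D: lattice "D L" by (rule lattice_D)
  have bq: "(Orig \<bottom>, Orig q) \<in> \<theta>"
  proof (cases "p = \<bottom>")
    case False
    then have bp: "\<bottom> \<sqsubset> p" using pq by (auto simp: lless_eq)
    let ?l = "Lft \<bottom> q"
    have l: "?l \<in> carrier (D L)" using bp pq by (auto simp: Lft_in_D_iff)
    have "(Orig p \<sqinter>\<^bsub>D L\<^esub> ?l, Orig q \<sqinter>\<^bsub>D L\<^esub> ?l) \<in> \<theta>"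
      by (rule congruence_meet[OF \<theta> pq(4) l])
    moreover have "Orig p \<sqinter>\<^bsub>D L\<^esub> ?l = Orig \<bottom>"
      using D_M3(2)[OF bp pq(3) _ pq(2,1)] by simp
    moreover have "Orig q \<sqinter>\<^bsub>D L\<^esub> ?l = ?l"
      using l pq by (intro D.meet_eq_right) (auto simp: D_le_iff)
    ultimately show ?thesis
      using congruence_D_M3[OF \<theta> bp pq(3) _ pq(2,1), of ?l] by simp
  qed (use pq in simp)
  show ?thesis
  proof (cases "q = \<top>")
    case False
    then have q: "\<bottom> \<sqsubset> q" "q \<sqsubset> \<top>"
      using pq bottom_lower[of p] le_antisym[of p q] by (auto simp: lless_eq bottom_lower top_higher)
    let ?l = "Lft \<bottom> \<top>"
    have l: "?l \<in> carrier (D L)" using q pq by (auto simp: Lft_in_D_iff)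
    have "(Orig \<bottom> \<squnion>\<^bsub>D L\<^esub> ?l, Orig q \<squnion>\<^bsub>D L\<^esub> ?l) \<in> \<theta>"
      by (rule congruence_join[OF \<theta> bq l])
    moreover have "Orig q \<squnion>\<^bsub>D L\<^esub> ?l = Orig \<top>"
      using D_M3(1)[OF q _ _ pq(2)] by simp
    moreover have "Orig \<bottom> \<squnion>\<^bsub>D L\<^esub> ?l = ?l"
      using l by (intro D.join_eq_right) (auto simp: D_le_iff)
    ultimately show ?thesis
      using congruence_D_M3[OF \<theta> q _ _ pq(2), of ?l] by simp
  qed (use bq in simp)
qed

theorem simple_lattice_D:
  assumes "\<bottom> \<noteq> \<top>"
  shows "simple_lattice (D L)"
proof -
  interpret D: lattice "D L" by (rule lattice_D)
  let ?C = "carrier (D L)"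
  have total: "\<theta> = ?C \<times> ?C" if \<theta>: "congruence (D L) \<theta>" and neq: "\<theta> \<noteq> Id_on ?C" for \<theta>
  proof -
    have "Id_on ?C \<subseteq> \<theta>" using congruence_refl[OF \<theta>] by auto
    then obtain x y where xy: "(x, y) \<in> \<theta>" "(x, y) \<notin> Id_on ?C"
      using neq by auto
    then have "x \<noteq> y" using congruence_subset[OF \<theta>] by auto
    then have bt: "(Orig \<bottom>, Orig \<top>) \<in> \<theta>"
      using congruence_D_restrict[OF \<theta> xy(1)] congruence_D_bottom_top[OF \<theta>] by blast
    have bz: "(Orig \<bottom>, z) \<in> \<theta>" if z: "z \<in> ?C" for z
    proof -
      have "Orig \<bottom> \<sqsubseteq>\<^bsub>D L\<^esub> z" "z \<sqsubseteq>\<^bsub>D L\<^esub> Orig \<top>" using z by (auto simp: D_le_iff)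
      then show ?thesis
        using congruence_meet[OF \<theta> bt z] z by (simp add: D.meet_eq_left D.meet_eq_right)
    qed
    then have "?C \<times> ?C \<subseteq> \<theta>"
      using congruence_sym[OF \<theta>] congruence_trans[OF \<theta>] by blast
    then show ?thesis using congruence_subset[OF \<theta>] by blast
  qed
  have "congruence (D L) (Id_on ?C)"
    by (auto simp: congruence_def equiv_def refl_on_def sym_def trans_def)
  moreover have "congruence (D L) (?C \<times> ?C)"
    by (auto simp: congruence_def equiv_def refl_on_def sym_def trans_def)
  moreover have "(Orig \<bottom>, Orig \<top>) \<in> ?C \<times> ?C - Id_on ?C" using assms by auto
  ultimately show ?thesis
    using total lattice_D unfolding simple_lattice_def Con_def by blast
qed

end

section \<open>Filters and ideals of \<open>D(L)\<close>\<close>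

text \<open>
  A minimal element \<open>m\<close> of a filter is its least element, because \<open>m \<sqinter> y\<close> belongs to the filter
  and lies below \<open>m\<close>. So every filter is principal.
\<close>

lemma (in lattice) Filt_eqpoll_carrier:
  assumes wf: "wf {(x, y). x \<in> carrier L \<and> y \<in> carrier L \<and> x \<sqsubset> y}" (is "wf ?R")
  shows "Filt L \<approx> carrier L"
proof -
  let ?up = "\<lambda>x. {y \<in> carrier L. x \<sqsubseteq> y}"
  have "inj_on ?up (carrier L)"
    by (rule inj_onI) (use le_antisym in blast)
  moreover have "?up ` carrier L = Filt L"
  proof
    show "?up ` carrier L \<subseteq> Filt L"
      by (auto simp: Filt_def intro: meet_le le_trans)
    show "Filt L \<subseteq> ?up ` carrier L"
    proof
      fix F assume F: "F \<in> Filt L"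
      then have sub: "F \<subseteq> carrier L" by (simp add: Filt_def)
      have "F \<noteq> {}" using F by (simp add: Filt_def)
      then have "\<exists>m\<in>F. \<forall>y. (y, m) \<in> ?R \<longrightarrow> y \<notin> F"
        by (rule wfE_min'[OF wf]) blast
      then obtain m where m: "m \<in> F" and "\<And>y. (y, m) \<in> ?R \<Longrightarrow> y \<notin> F"
        by blast
      then have min: "\<not> y \<sqsubset> m" if "y \<in> F" for y
        using that sub by blast
      have least: "m \<sqsubseteq> y" if y: "y \<in> F" for y
      proof -
        have "m \<sqinter> y \<in> F" using F m y by (simp add: Filt_def)
        then have "m \<sqinter> y = m"
          using min[of "m \<sqinter> y"] meet_left[of m y] m y sub by (auto simp: lless_eq)
        then show ?thesis using meet_right[of m y] m y sub by auto
      qed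
      have "F = ?up m"
      proof
        show "F \<subseteq> ?up m" using least sub by blast
        have "\<forall>y\<in>carrier L. m \<sqsubseteq> y \<longrightarrow> y \<in> F" using F m unfolding Filt_def by blast
        then show "?up m \<subseteq> F" by blast
      qed
      then show "F \<in> ?up ` carrier L" using m sub by auto
    qed
  qed
  ultimately show ?thesis
    by (metis inj_on_image_eqpoll_self)
qed

text \<open>
  Going strictly down in \<open>D(L)\<close> never raises \<open>lo\<close> or \<open>hi\<close>, and it lowers at least one of the two.
\<close>

lemma (in lattice) wf_D:
  assumes wf: "wf {(x, y). x \<in> carrier L \<and> y \<in> carrier L \<and> x \<sqsubset> y}" (is "wf ?R")
  shows "wf {(x, y). x \<in> carrier (D L) \<and> y \<in> carrier (D L) \<and> x \<sqsubset>\<^bsub>D L\<^esub> y}" (is "wf ?S")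
proof -
  have "?S \<subseteq> inv_image (?R <*lex*> ?R) (\<lambda>x. (lo x, hi x))"
  proof (rule subrelI)
    fix x y assume "(x, y) \<in> ?S"
    then have xy: "x \<in> carrier (D L)" "y \<in> carrier (D L)" "x \<sqsubseteq>\<^bsub>D L\<^esub> y" "x \<noteq> y"
      by (auto simp: lless_def)
    then have le: "lo x \<sqsubseteq> lo y" "hi x \<sqsubseteq> hi y" "hi x \<sqsubseteq> lo y"
      using D_le_lo_hi D_le_iff by auto
    have "hi x \<noteq> hi y" if "lo x = lo y"
    proof
      assume "hi x = hi y"
      then have "lo x = hi x" "lo y = hi y"
        using that le(3) lo_le_hi[OF xy(1)] le_antisym xy by auto
      then show False using lo_eq_hi_iff xy that by metis
    qed
    then show "(x, y) \<in> inv_image (?R <*lex*> ?R) (\<lambda>x. (lo x, hi x))"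
      using le xy by (auto simp: lless_eq)
  qed
  then show ?thesis using wf by (meson wf_inv_image wf_lex_prod wf_subset)
qed

text \<open>
  The set of all \<open>x\<close> with \<open>hi x \<in> J\<close> is the ideal of \<open>D(L)\<close> generated by \<open>J\<close>; its trace on \<open>L\<close> is
  \<open>J\<close> again, which gives injectivity.
\<close>

lemma (in lattice) Idl_lepoll_Idl_D: "Idl L \<lesssim> Idl (D L)"
proof -
  interpret D: lattice "D L" by (rule lattice_D)
  let ?f = "\<lambda>J. {x \<in> carrier (D L). hi x \<in> J}"
  have "inj_on ?f (Idl L)"
    by (rule inj_on_inverseI[where g = "\<lambda>I. {x. Orig x \<in> I}"]) (auto simp: Idl_def)
  moreover have "?f J \<in> Idl (D L)" if J: "J \<in> Idl L" for J
  proof -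
    have down: "y \<in> J" if "x \<in> J" "y \<in> carrier L" "y \<sqsubseteq> x" for x y
      using J that by (auto simp: Idl_def)
    have downD: "y \<in> ?f J" if "x \<in> ?f J" "y \<in> carrier (D L)" "y \<sqsubseteq>\<^bsub>D L\<^esub> x" for x y
      using that D_le_lo_hi(2)[of y x] down[of "hi x" "hi y"] by auto
    have "x \<squnion>\<^bsub>D L\<^esub> y \<in> ?f J" if xy: "x \<in> ?f J" "y \<in> ?f J" for x y
    proof (rule downD)
      have "hi x \<squnion> hi y \<in> J" using xy J by (auto simp: Idl_def)
      then show "Orig (hi x \<squnion> hi y) \<in> ?f J" using xy by auto
      show "x \<squnion>\<^bsub>D L\<^esub> y \<sqsubseteq>\<^bsub>D L\<^esub> Orig (hi x \<squnion> hi y)"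
        using xy by (intro D.join_le) (auto simp: D_le_iff join_left join_right)
    qed (use xy in auto)
    moreover obtain x where "x \<in> J" "x \<in> carrier L" using J unfolding Idl_def by blast
    then have "Orig x \<in> ?f J" by simp
    ultimately show ?thesis using downD unfolding Idl_def by blast
  qed
  ultimately show ?thesis unfolding lepoll_def by blast
qed

section \<open>The divisibility lattice\<close>

text \<open>
  The top element \<open>0\<close> is the largest number for divisibility but the smallest in size, so size
  alone does not decrease along divisors. The first component ranks \<open>0\<close> above everything else.
\<close>

lemma wf_nat_dvd: "wf {(x, y). x \<in> carrier nat_dvd \<and> y \<in> carrier nat_dvd \<and> x \<sqsubset>\<^bsub>nat_dvd\<^esub> y}"
proof (rule wf_subset)
  show "wf (inv_image (less_than <*lex*> less_than) (\<lambda>n::nat. (if n = 0 then 1 else 0::nat, n)))"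
    by (intro wf_inv_image wf_lex_prod wf_less_than)
next
  show "{(x, y). x \<in> carrier nat_dvd \<and> y \<in> carrier nat_dvd \<and> x \<sqsubset>\<^bsub>nat_dvd\<^esub> y}
      \<subseteq> inv_image (less_than <*lex*> less_than) (\<lambda>n::nat. (if n = 0 then 1 else 0::nat, n))"
  proof (rule subrelI)
    fix x y assume "(x, y) \<in> {(x, y). x \<in> carrier nat_dvd \<and> y \<in> carrier nat_dvd \<and> x \<sqsubset>\<^bsub>nat_dvd\<^esub> y}"
    then have "x dvd y" "x \<noteq> y" by (auto simp: lless_def)
    moreover from this have "x < y" if "y \<noteq> 0" using that dvd_imp_le[of x y] by simp
    ultimately show "(x, y) \<in> inv_image (less_than <*lex*> less_than) (\<lambda>n. (if n = 0 then 1 else 0::nat, n))"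
      by (cases "y = 0") auto
  qed
qed

lemma countable_D_elem: "countable (UNIV :: 'a::countable D_elem set)"
proof -
  have "UNIV = range Orig \<union> range (case_prod Lft) \<union> range (case_prod Rgt :: _ \<Rightarrow> 'a D_elem)"
  proof -
    have "x \<in> range Orig \<union> range (case_prod Lft) \<union> range (case_prod Rgt)" for x :: "'a D_elem"
      by (cases x) (auto simp: image_iff)
    then show ?thesis by blast
  qed
  moreover have "countable \<dots>" by (intro countable_Un countable_image) auto
  ultimately show ?thesis by simp
qed

lemma Pow_lepoll_Pow:
  assumes "A \<lesssim> B"
  shows "Pow A \<lesssim> Pow B"
proof -
  obtain f where "inj_on f A" "f ` A \<subseteq> B" using assms by (auto simp: lepoll_def)
  then have "inj_on (image f) (Pow A)" "image f ` Pow A \<subseteq> Pow B"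
    by (auto intro: inj_on_image_Pow)
  then show ?thesis unfolding lepoll_def by blast
qed

lemma Idl_nat_dvdI:
  assumes "I \<noteq> {}"
    and "\<And>x y. x \<in> I \<Longrightarrow> y \<in> I \<Longrightarrow> lcm x y \<in> I"
    and "\<And>x y. x \<in> I \<Longrightarrow> y dvd x \<Longrightarrow> y \<in> I"
  shows "I \<in> Idl nat_dvd"
  using assms by (simp add: Idl_def nat_dvd_join)

text \<open>
  Ideals are built from sets of primes. The top element \<open>0\<close>, a multiple of every prime, has to
  be excluded: an ideal that contains it is everything. By the restriction to \<open>n \<noteq> 0\<close>, a prime
  \<open>p\<close> lies in the ideal exactly if it belongs to the chosen set.
\<close>

lemma Pow_nat_lepoll_Idl_nat_dvd: "Pow (UNIV :: nat set) \<lesssim> Idl nat_dvd"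
proof -
  let ?P = "{p::nat. prime p}"
  let ?I = "\<lambda>A. {n::nat. n \<noteq> 0 \<and> (\<forall>p. prime p \<longrightarrow> p dvd n \<longrightarrow> p \<in> A)}"
  obtain e :: "nat \<Rightarrow> nat" where e: "inj e" "range e \<subseteq> ?P"
    using primes_infinite infinite_le_lepoll[of ?P] by (auto simp: lepoll_def)
  have mem: "p \<in> ?I A \<longleftrightarrow> p \<in> A" if "prime p" for p A
    using that by (auto dest: primes_dvd_imp_eq intro: prime_gt_0_nat)
  have inj: "inj (\<lambda>A. ?I (e ` A))"
  proof (rule inj_on_inverseI[where g = "\<lambda>I. {i. e i \<in> I}"])
    fix A
    have "e i \<in> ?I (e ` A) \<longleftrightarrow> i \<in> A" for i
    proof -
      have "prime (e i)" using e(2) by blast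
      from mem[OF this] show ?thesis
        by (rule trans) (rule inj_image_mem_iff[OF e(1)])
    qed
    then show "{i. e i \<in> ?I (e ` A)} = A" by (simp only: Collect_mem_eq)
  qed
  have ideal: "?I A \<in> Idl nat_dvd" for A
  proof -
    have one: "1 \<in> ?I A" by (auto dest: not_prime_unit)
    have lcm: "lcm x y \<in> ?I A" if "x \<in> ?I A" "y \<in> ?I A" for x y
    proof -
      have "p dvd x \<or> p dvd y" if "prime p" "p dvd lcm x y" for p
        using that dvd_trans[of p "lcm x y" "x * y"] prime_dvd_mult_iff[of p x y] by auto
      with that show ?thesis by (auto intro: lcm_pos_nat)
    qed
    have dvd: "y \<in> ?I A" if "x \<in> ?I A" "y dvd x" for x y
    proof -
      have "y \<noteq> 0" using that by auto
      then show ?thesis using that dvd_trans[of _ y x] by blast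
    qed
    have "?I A \<noteq> {}" using one by blast
    then show ?thesis using lcm dvd by (rule Idl_nat_dvdI)
  qed
  show ?thesis
    unfolding lepoll_def
  proof (intro exI conjI)
    show "inj_on (\<lambda>A. ?I (e ` A)) (Pow UNIV)" using inj by simp
    show "(\<lambda>A. ?I (e ` A)) ` Pow UNIV \<subseteq> Idl nat_dvd"
      by (rule image_subsetI) (rule ideal)
  qed
qed

theorem mainTheorem3:
  shows "bounded_lattice (D nat_dvd) \<and>
    simple_lattice (D nat_dvd) \<and>
    Filt (D nat_dvd) \<approx> (UNIV :: nat set) \<and>
    Idl (D nat_dvd) \<approx> Pow (UNIV :: nat set) \<and>
    \<not> Con (D nat_dvd) \<approx> Filt (D nat_dvd) \<and>
    \<not> Con (D nat_dvd) \<approx> Idl (D nat_dvd) \<and>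
    \<not> Filt (D nat_dvd) \<approx> Idl (D nat_dvd)"
proof -
  let ?C = "carrier (D nat_dvd)"
  interpret D: bounded_lattice "D nat_dvd" by (rule nat_dvd.bounded_lattice_D)
  have simple: "simple_lattice (D nat_dvd)"
    by (rule nat_dvd.simple_lattice_D) (simp add: nat_dvd_bottom nat_dvd_top)
  have C: "?C \<lesssim> (UNIV :: nat set)"
    using countable_subset[OF subset_UNIV countable_D_elem, of ?C]
    by (auto simp: countable_def lepoll_def)
  have "range Orig \<subseteq> ?C" by auto
  then have "(UNIV :: nat set) \<lesssim> ?C"
    unfolding lepoll_def by (intro exI[of _ Orig]) (auto simp: inj_on_def)
  with C have "?C \<approx> (UNIV :: nat set)" by (rule lepoll_antisym)
  then have Filt: "Filt (D nat_dvd) \<approx> (UNIV :: nat set)"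
    using D.Filt_eqpoll_carrier[OF nat_dvd.wf_D[OF wf_nat_dvd]] eqpoll_trans by blast
  have "Idl (D nat_dvd) \<lesssim> Pow ?C"
    by (rule subset_imp_lepoll) (auto simp: Idl_def)
  also have "Pow ?C \<lesssim> Pow (UNIV :: nat set)"
    using C by (rule Pow_lepoll_Pow)
  finally have Idl: "Idl (D nat_dvd) \<approx> Pow (UNIV :: nat set)"
    using lepoll_trans[OF Pow_nat_lepoll_Idl_nat_dvd nat_dvd.Idl_lepoll_Idl_D]
    by (rule lepoll_antisym)
  have "finite (Con (D nat_dvd))" using simple by (simp add: simple_lattice_def)
  moreover have "infinite (Filt (D nat_dvd))" using eqpoll_finite_iff[OF Filt] by simp
  moreover have "infinite (Idl (D nat_dvd))"
    using eqpoll_finite_iff[OF Idl] by (metis finite_Pow_iff infinite_UNIV_nat)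
  moreover have "\<not> Filt (D nat_dvd) \<approx> Idl (D nat_dvd)"
    using lesspoll_Pow_self[of "UNIV :: nat set"] Filt Idl
    by (meson eqpoll_sym eqpoll_trans lesspoll_def)
  ultimately show ?thesis
    using D.bounded_lattice_axioms simple Filt Idl eqpoll_finite_iff by blast
qed

end
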